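(* Let $\lambda\in\mathbb{R}$ and let $v \ge 0$ be a nontrivial weak solution of $$L_\Delta v = \lambda v \ \text{ in } \Omega, \qquad v = 0 \ \text{ in } \mathbb{R}^N\setminus\Omega .$$ Then $\lambda = \lambda_1^L$. In other words, if $u$ is any nontrivial weak solution of this problem with $\lambda > \lambda_1^L$, then $u$ is a sign-changing function.
   Context: Let $N\ge 1$ be an integer and let $\Omega\subset\mathbb{R}^N$ be a bounded domain (open and connected) with $C^{1,1}$ boundary. $\|\cdot\|_2$ is the $L^2(\Omega)$ norm. Put $c_N=\pi^{-N/2}\Gamma(N/2)$ and $\rho_N=2\ln 2+\psi(N/2)-\gamma$, with $\psi=\Gamma'/\Gamma$ the digamma function and $\gamma=-\Gamma'(1)$; $B_1$ is the unit ball centred at $0$, $k(z)=\mathbf 1_{B_1}(z)|z|^{-N}$, $j(z)=\mathbf 1_{\mathbb{R}^N\setminus B_1}(z)|z|^{-N}$ for $z\neq 0$. $\mathbb{H}(\Omega)$ is the Hilbert space of all $u\in L^2(\Omega)$, extended by $u=0$ in $\mathbb{R}^N\setminus\Omega$, with $\iint_{\mathbb{R}^{2N}}|u(x)-u(y)|^2k(x-y)\,dx\,dy<\infty$, with inner product $\mathcal{E}(u,v)=\frac{c_N}{2}\iint_{\mathbb{R}^{2N}}(u(x)-u(y))(v(x)-v(y))k(x-y)\,dx\,dy$. The quadratic form of the logarithmic Laplacian $L_\Delta$ (the operator with Fourier symbol $2\ln|\xi|$) is $$\mathcal{E}_L(u,v)=\mathcal{E}(u,v)-c_N\iint_{\mathbb{R}^{2N}}u(x)v(y)j(x-y)\,dx\,dy+\rho_N\int_{\mathbb{R}^N}uv\,dx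 .$$ A weak solution of $L_\Delta v=\lambda v$ in $\Omega$, $v=0$ in $\mathbb{R}^N\setminus\Omega$, is a $v\in\mathbb{H}(\Omega)$ with $\mathcal{E}_L(v,\phi)=\lambda\int_\Omega v\phi\,dx$ for all $\phi\in\mathbb{H}(\Omega)$. The first eigenvalue is $\lambda_1^L=\min\{\mathcal{E}_L(u,u):u\in\mathbb{H}(\Omega),\ \|u\|_2=1\}$. A function is sign-changing in $\Omega$ if the subsets of $\Omega$ where it is positive and where it is negative both have positive measure. *)

theory Defs
  imports "HOL-Analysis.Analysis"
begin

text \<open>Throughout, \<open>\<real>\<^sup>N\<close> is an arbitrary Euclidean space \<open>'a\<close> with \<open>N = DIM('a)\<close>.\<close>

definition C11_function :: "('a::euclidean_space \<Rightarrow> real) \<Rightarrow> bool" where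
  "C11_function \<gamma> \<longleftrightarrow>
     (\<exists>g L. (\<forall>y. (\<gamma> has_derivative (\<lambda>h. g y \<bullet> h)) (at y)) \<and> L-lipschitz_on UNIV g)"

text \<open>Near every boundary point, \<open>\<Omega>\<close> is the strict epigraph of a \<open>C\<^sup>1\<^sup>,\<^sup>1\<close> function in a
  rotated coordinate system. The unit vector \<open>e\<close> is the vertical direction, \<open>x \<bullet> e\<close> the
  vertical coordinate, and \<open>x - (x \<bullet> e) *\<^sub>R e\<close> the projection to the horizontal hyperplane
  \<open>e\<^sup>\<bottom>\<close>. A function on that hyperplane is represented by a function \<open>\<gamma>\<close> on the whole space,
  of which only the values on the hyperplane are used. For \<open>N = 1\<close> the hyperplane is \<open>{0}\<close>
  and \<open>\<Omega>\<close> is locally a half-line.\<close>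

definition C11_boundary :: "'a::euclidean_space set \<Rightarrow> bool" where
  "C11_boundary \<Omega> \<longleftrightarrow>
     (\<forall>p \<in> frontier \<Omega>. \<exists>r > 0. \<exists>e \<gamma>. norm e = 1 \<and> C11_function \<gamma> \<and>
        \<Omega> \<inter> ball p r = {x \<in> ball p r. x \<bullet> e > \<gamma> (x - (x \<bullet> e) *\<^sub>R e)})"

definition bounded_C11_domain :: "'a::euclidean_space set \<Rightarrow> bool" where
  "bounded_C11_domain \<Omega> \<longleftrightarrow>
     open \<Omega> \<and> connected \<Omega> \<and> \<Omega> \<noteq> {} \<and> bounded \<Omega> \<and> C11_boundary \<Omega>"

definition c_const :: "nat \<Rightarrow> real" where
  "c_const N = pi powr (- real N / 2) * Gamma (real N / 2)"

definition rho_const :: "nat \<Rightarrow> real" where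
  "rho_const N = 2 * ln 2 + Digamma (real N / 2) - euler_mascheroni"

text \<open>The library constants agree with \<open>\<psi> = \<Gamma>' / \<Gamma>\<close> and \<open>\<gamma> = - \<Gamma>'(1)\<close>.\<close>

lemma Digamma_eq_deriv_Gamma_over_Gamma:
  fixes x :: real
  assumes "x > 0"
  shows "Digamma x = deriv Gamma x / Gamma x"
proof -
  have x: "x \<notin> \<int>\<^sub>\<le>\<^sub>0"
    using assms by (auto elim!: nonpos_Ints_cases)
  have "deriv Gamma x = Gamma x * Digamma x"
    by (rule DERIV_imp_deriv, rule has_field_derivative_Gamma) (use x in auto)
  moreover have "Gamma x \<noteq> 0"
    using Gamma_real_pos[OF assms] by simp
  ultimately show ?thesis by simp
qed

lemma euler_mascheroni_eq_deriv_Gamma: "euler_mascheroni = - deriv Gamma (1::real)"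
  using Digamma_eq_deriv_Gamma_over_Gamma[of 1] by simp

text \<open>The kernels \<open>k\<close> and \<open>j\<close>; the value \<open>k 0 = 0\<close> resulting from division by zero concerns
  only the diagonal of \<open>\<real>\<^sup>N \<times> \<real>\<^sup>N\<close>, a null set.\<close>

definition kernel_k :: "'a::euclidean_space \<Rightarrow> real" where
  "kernel_k z = indicator (ball 0 1) z / norm z ^ DIM('a)"

definition kernel_j :: "'a::euclidean_space \<Rightarrow> real" where
  "kernel_j z = indicator (- ball 0 1) z / norm z ^ DIM('a)"

text \<open>Elements of \<open>H(\<Omega>)\<close> are represented by Lebesgue measurable functions on the
  whole space that vanish outside \<open>\<Omega>\<close>; equality in \<open>H(\<Omega>)\<close> is equality almost everywhere.\<close>

definition H_space :: "'a::euclidean_space set \<Rightarrow> ('a \<Rightarrow> real) set" where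
  "H_space \<Omega> = {u. u \<in> borel_measurable lebesgue \<and>
      set_integrable lebesgue \<Omega> (\<lambda>x. (u x)\<^sup>2) \<and>
      (\<forall>x. x \<notin> \<Omega> \<longrightarrow> u x = 0) \<and>
      (\<integral>\<^sup>+ (x, y). ennreal (\<bar>u x - u y\<bar>\<^sup>2 * kernel_k (x - y)) \<partial>lebesgue) < \<infinity>}"

definition L2_norm_on :: "'a::euclidean_space set \<Rightarrow> ('a \<Rightarrow> real) \<Rightarrow> real" where
  "L2_norm_on \<Omega> u = sqrt (\<integral>x\<in>\<Omega>. (u x)\<^sup>2 \<partial>lebesgue)"

definition form_E :: "('a::euclidean_space \<Rightarrow> real) \<Rightarrow> ('a \<Rightarrow> real) \<Rightarrow> real" where
  "form_E u v = c_const DIM('a) / 2 *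
     (\<integral>(x, y). (u x - u y) * (v x - v y) * kernel_k (x - y) \<partial>lebesgue)"

definition form_EL :: "('a::euclidean_space \<Rightarrow> real) \<Rightarrow> ('a \<Rightarrow> real) \<Rightarrow> real" where
  "form_EL u v = form_E u v
     - c_const DIM('a) * (\<integral>(x, y). u x * v y * kernel_j (x - y) \<partial>lebesgue)
     + rho_const DIM('a) * (\<integral>x. u x * v x \<partial>lebesgue)"

text \<open>Weak solutions of \<open>L\<^sub>\<Delta> v = \<lambda> v\<close> in \<open>\<Omega>\<close>, \<open>v = 0\<close> outside \<open>\<Omega>\<close>.\<close>

definition weak_solution :: "'a::euclidean_space set \<Rightarrow> real \<Rightarrow> ('a \<Rightarrow> real) \<Rightarrow> bool" where
  "weak_solution \<Omega> lam v \<longleftrightarrow> v \<in> H_space \<Omega> \<and>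
     (\<forall>\<phi> \<in> H_space \<Omega>. form_EL v \<phi> = lam * (\<integral>x\<in>\<Omega>. v x * \<phi> x \<partial>lebesgue))"

text \<open>\<open>LEAST\<close> is the minimum of the set of values \<open>\<E>\<^sub>L(u,u)\<close>, rather than its infimum.\<close>

definition lambda1 :: "'a::euclidean_space set \<Rightarrow> real" where
  "lambda1 \<Omega> = (LEAST m. m \<in> {form_EL u u | u. u \<in> H_space \<Omega> \<and> L2_norm_on \<Omega> u = 1})"

definition nontrivial :: "('a::euclidean_space \<Rightarrow> real) \<Rightarrow> bool" where
  "nontrivial u \<longleftrightarrow> \<not> (AE x in lebesgue. u x = 0)"

definition sign_changing :: "'a::euclidean_space set \<Rightarrow> ('a \<Rightarrow> real) \<Rightarrow> bool" where
  "sign_changing \<Omega> u \<longleftrightarrow>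
     emeasure lebesgue {x \<in> \<Omega>. u x > 0} > 0 \<and> emeasure lebesgue {x \<in> \<Omega>. u x < 0} > 0"

end

theory Submission
  imports Defs
begin

text \<open>The proof is a Picone argument: a nonnegative nontrivial solution \<open>v\<close> with eigenvalue \<open>lam\<close> forces \<open>\<E>\<^sub>L(u,u) \<ge> lam \<parallel>u\<parallel>\<^sup>2\<close> for every \<open>u\<close> in the form
  domain. As \<open>v / \<parallel>v\<parallel>\<close> attains equality, the minimum defining \<open>\<lambda>\<^sub>1\<close> exists and equals \<open>lam\<close>. A solution with a larger
  eigenvalue then cannot have a constant sign, because up to its own sign it would be a
  nonnegative solution.

  The lower bound comes from testing the equation for \<open>v\<close> with \<open>\<phi> = u\<^sup>2 / (v + \<epsilon>)\<close>, where \<open>u\<close> is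
  truncated at a level that grows as \<open>\<epsilon>\<close> decreases, so that \<open>\<phi>\<close> is a Lipschitz function of
  \<open>(u, v)\<close> and lies in the form domain. In the singular part, Picone's inequality
  \<open>(v(x) - v(y)) (\<phi>(x) - \<phi>(y)) \<le> (u(x) - u(y))\<^sup>2\<close> bounds \<open>\<E>(v,\<phi>)\<close> by \<open>\<E>(u,u)\<close>, with a
  nonnegative deficit. In the long-range part, symmetry and the inequality between arithmetic and
  geometric means show that \<open>v(x) \<phi>(y) + v(y) \<phi>(x)\<close> dominates \<open>2 \<psi>(x) \<psi>(y)\<close> with
  \<open>\<psi> = \<bar>u\<bar> (v / (v + \<epsilon>))\<^sup>1\<^sup>/\<^sup>2\<close>. If \<open>u\<close> vanishes where \<open>v\<close> does, then \<open>\<psi>\<close> tends to \<open>\<bar>u\<bar>\<close>, and dominated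
  convergence gives the bound (\<open>nonneg_solution_form_bound\<close>).

  That \<open>u\<close> vanishes almost everywhere on \<open>{v = 0}\<close> is the strong maximum principle for this
  operator, and it follows from the same test function (\<open>vanishes_on_zero_set\<close>). The deficit and
  the long-range term stay bounded as \<open>\<epsilon>\<close> tends to \<open>0\<close>, whereas at pairs with \<open>v(x) > 0\<close>,
  \<open>v(y) = 0\<close> and \<open>u(y) \<noteq> 0\<close> they grow like \<open>1/\<epsilon>\<close>. As the kernels \<open>k\<close> and \<open>j\<close> together charge all
  pairs of distinct points, however far apart, these pairs form a null set, which is a product;
  one of its factors is therefore null, and it is not \<open>{v > 0}\<close>.\<close>

section \<open>Lebesgue measurable functions of one variable on the product space\<close>

text \<open>The double integrals are taken over the completed measure of the product space, which is
  larger than the product of the completed measures. One-variable statements are moved to it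
  through Borel sets and Borel representatives, where \<open>lborel_prod\<close> applies.\<close>

lemma AE_lebesgue_fst:
  assumes "AE x in (lebesgue :: 'a::euclidean_space measure). P x"
  shows "AE z in (lebesgue :: ('a \<times> 'b::euclidean_space) measure). P (fst z)"
proof -
  have "AE x in (lborel :: 'a measure). P x"
    using assms unfolding AE_completion_iff .
  then obtain N where N: "N \<in> null_sets (lborel :: 'a measure)" "{x. \<not> P x} \<subseteq> N"
    by (auto simp: eventually_ae_filter)
  have "N \<times> UNIV \<in> null_sets (lborel \<Otimes>\<^sub>M (lborel :: 'b measure))"
    using N(1) by (rule lborel.times_in_null_sets1) simp
  then have "AE z in lborel \<Otimes>\<^sub>M (lborel :: 'b measure). P (fst z)"
    by (rule AE_I') (use N(2) in auto)
  then show ?thesis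
    unfolding lborel_prod by (rule AE_completion)
qed

lemma AE_lebesgue_snd:
  assumes "AE x in (lebesgue :: 'b::euclidean_space measure). P x"
  shows "AE z in (lebesgue :: ('a::euclidean_space \<times> 'b) measure). P (snd z)"
proof -
  have "AE x in (lborel :: 'b measure). P x"
    using assms unfolding AE_completion_iff .
  then obtain N where N: "N \<in> null_sets (lborel :: 'b measure)" "{x. \<not> P x} \<subseteq> N"
    by (auto simp: eventually_ae_filter)
  have "UNIV \<times> N \<in> null_sets ((lborel :: 'a measure) \<Otimes>\<^sub>M lborel)"
    using _ N(1) by (rule lborel.times_in_null_sets2) simp
  then have "AE z in (lborel :: 'a measure) \<Otimes>\<^sub>M lborel. P (snd z)"
    by (rule AE_I') (use N(2) in auto)
  then show ?thesis
    unfolding lborel_prod by (rule AE_completion)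
qed

lemma borel_representative:
  fixes f :: "'a::euclidean_space \<Rightarrow> real"
  assumes "f \<in> borel_measurable lebesgue"
  obtains g where "g \<in> borel_measurable borel" "AE x in lebesgue. f x = g x"
  using completion_ex_borel_measurable_real[OF assms] by (auto simp: AE_completion_iff)

lemma borel_measurable_lebesgue_fst:
  fixes f :: "'a::euclidean_space \<Rightarrow> real"
  assumes "f \<in> borel_measurable lebesgue"
  shows "(\<lambda>z. f (fst z)) \<in> borel_measurable (lebesgue :: ('a \<times> 'b::euclidean_space) measure)"
proof -
  obtain g where g [measurable]: "g \<in> borel_measurable borel" and fg: "AE x in lebesgue. f x = g x"
    using borel_representative[OF assms] .
  have "(\<lambda>z :: 'a \<times> 'b. g (fst z)) \<in> borel_measurable lebesgue"
    by (intro measurable_completion) (simp add: lborel_prod[symmetric])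
  moreover have "AE z in (lebesgue :: ('a \<times> 'b) measure). g (fst z) = f (fst z)"
    using AE_lebesgue_fst[OF fg] by auto
  ultimately show ?thesis by (rule borel_measurable_AE)
qed

lemma borel_measurable_lebesgue_snd:
  fixes f :: "'b::euclidean_space \<Rightarrow> real"
  assumes "f \<in> borel_measurable lebesgue"
  shows "(\<lambda>z. f (snd z)) \<in> borel_measurable (lebesgue :: ('a::euclidean_space \<times> 'b) measure)"
proof -
  obtain g where g [measurable]: "g \<in> borel_measurable borel" and fg: "AE x in lebesgue. f x = g x"
    using borel_representative[OF assms] .
  have "(\<lambda>z :: 'a \<times> 'b. g (snd z)) \<in> borel_measurable lebesgue"
    by (intro measurable_completion) (simp add: lborel_prod[symmetric])
  moreover have "AE z in (lebesgue :: ('a \<times> 'b) measure). g (snd z) = f (snd z)"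
    using AE_lebesgue_snd[OF fg] by auto
  ultimately show ?thesis by (rule borel_measurable_AE)
qed

lemma borel_measurable_lebesgue_diff_arg:
  fixes h :: "'a::euclidean_space \<Rightarrow> real"
  assumes [measurable]: "h \<in> borel_measurable borel"
  shows "(\<lambda>z. h (fst z - snd z)) \<in> borel_measurable (lebesgue :: ('a \<times> 'a) measure)"
proof (rule measurable_completion)
  show "(\<lambda>z. h (fst z - snd z)) \<in> borel_measurable (lborel :: ('a \<times> 'a) measure)"
    by (simp add: lborel_prod[symmetric])
qed

lemma AE_lebesgue_not_both:
  assumes "AE z in (lebesgue :: ('a::euclidean_space \<times> 'b::euclidean_space) measure).
             \<not> (P (fst z) \<and> Q (snd z))"
  shows "(AE x in lebesgue. \<not> P x) \<or> (AE y in lebesgue. \<not> Q y)"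
proof -
  have "AE z in (lborel :: 'a measure) \<Otimes>\<^sub>M (lborel :: 'b measure). \<not> (P (fst z) \<and> Q (snd z))"
    using assms unfolding lborel_prod AE_completion_iff .
  from lborel_pair.AE_pair[OF this]
  have ae: "AE x in (lborel :: 'a measure). AE y in (lborel :: 'b measure). P x \<longrightarrow> \<not> Q y"
    by simp
  show ?thesis
  proof (cases "AE y in (lborel :: 'b measure). \<not> Q y")
    case False
    from ae have "AE x in (lborel :: 'a measure). \<not> P x"
      by eventually_elim (use False in auto)
    then show ?thesis by (simp add: AE_completion_iff)
  qed (simp add: AE_completion_iff)
qed

section \<open>The kernels\<close>

lemma kernel_k_nonneg: "0 \<le> kernel_k z"
  by (simp add: kernel_k_def)

lemma kernel_j_nonneg: "0 \<le> kernel_j z"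
  by (simp add: kernel_j_def)

lemma kernel_j_le_1: "kernel_j (z::'a::euclidean_space) \<le> 1"
proof (cases "norm z < 1")
  case False
  then have "1 \<le> norm z ^ DIM('a)" by (simp add: one_le_power)
  then show ?thesis by (simp add: kernel_j_def divide_le_eq indicator_def)
qed (simp add: kernel_j_def)

lemma kernel_j_minus_commute: "kernel_j (x - y) = kernel_j (y - x)"
  by (simp add: kernel_j_def norm_minus_commute indicator_def dist_norm)

lemma kernel_k_or_j_pos: "z \<noteq> 0 \<Longrightarrow> 0 < kernel_k z \<or> 0 < kernel_j z"
  by (cases "norm z < 1") (auto simp: kernel_k_def kernel_j_def)

lemma borel_measurable_kernel_k [measurable]: "kernel_k \<in> borel_measurable borel"
  unfolding kernel_k_def
  by (intro borel_measurable_divide borel_measurable_indicator borel_measurable_power) auto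

lemma borel_measurable_kernel_j [measurable]: "kernel_j \<in> borel_measurable borel"
  unfolding kernel_j_def
  by (intro borel_measurable_divide borel_measurable_indicator borel_measurable_power) auto

lemma c_const_pos: "0 < n \<Longrightarrow> 0 < c_const n"
  by (simp add: c_const_def)

text \<open>Since \<open>j\<close> is bounded by \<open>1\<close> and even, Fubini's theorem applies to Borel representatives of \<open>f\<close>
  and \<open>g\<close>, and exchanging the variables exchanges the roles of \<open>f\<close> and \<open>g\<close>.\<close>

lemma
  fixes f g :: "'a::euclidean_space \<Rightarrow> real"
  assumes f: "integrable lebesgue f" and g: "integrable lebesgue g"
  shows integrable_tensor_kernel_j:
      "integrable lebesgue (\<lambda>(x, y). f x * g y * kernel_j (x - y))"
    and integral_tensor_kernel_j_commute:
      "(\<integral>(x, y). f x * g y * kernel_j (x - y) \<partial>lebesgue)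
        = (\<integral>(x, y). g x * f y * kernel_j (x - y) \<partial>lebesgue)"
proof -
  obtain F where F [measurable]: "F \<in> borel_measurable borel" and fF: "AE x in lebesgue. f x = F x"
    using borel_representative[OF borel_measurable_integrable[OF f]] .
  obtain G where G [measurable]: "G \<in> borel_measurable borel" and gG: "AE x in lebesgue. g x = G x"
    using borel_representative[OF borel_measurable_integrable[OF g]] .
  have intF: "integrable lborel F" and intG: "integrable lborel G"
    using f g integrable_cong_AE[OF _ _ fF] integrable_cong_AE[OF _ _ gG]
    by (simp_all add: borel_measurable_integrable measurable_completion integrable_completion)
  have mF: "(\<lambda>(x, y). F x * G y * kernel_j (x - y)) \<in> borel_measurable (lborel \<Otimes>\<^sub>M lborel)"
    by (simp add: split_beta')
  have mG: "(\<lambda>(x, y). G x * F y * kernel_j (x - y)) \<in> borel_measurable (lborel \<Otimes>\<^sub>M lborel)"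
    by (simp add: split_beta')
  have "integrable (lborel \<Otimes>\<^sub>M lborel) (\<lambda>(x, y). F x * G y)"
    by (rule lborel_pair.Fubini_integrable)
      (use intF intG in \<open>auto simp: abs_mult split_beta'\<close>)
  then have FG: "integrable (lborel \<Otimes>\<^sub>M lborel) (\<lambda>(x, y). F x * G y * kernel_j (x - y))"
    using mF
    by (rule Bochner_Integration.integrable_bound)
      (auto simp: abs_mult kernel_j_nonneg kernel_j_le_1 mult_left_le)
  have mf: "f \<in> borel_measurable lebesgue" and mg: "g \<in> borel_measurable lebesgue"
    using f g by (simp_all add: borel_measurable_integrable)
  note ms = borel_measurable_lebesgue_fst borel_measurable_lebesgue_snd
    borel_measurable_lebesgue_diff_arg borel_measurable_times
  have mfg: "(\<lambda>(x, y). f x * g y * kernel_j (x - y)) \<in> borel_measurable lebesgue"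
    and mgf: "(\<lambda>(x, y). g x * f y * kernel_j (x - y)) \<in> borel_measurable lebesgue"
    unfolding split_beta' by (intro ms mf mg borel_measurable_kernel_j)+
  have mFG': "(\<lambda>(x, y). F x * G y * kernel_j (x - y)) \<in> borel_measurable lebesgue"
    and mGF': "(\<lambda>(x, y). G x * F y * kernel_j (x - y)) \<in> borel_measurable lebesgue"
    using mF mG by (simp_all add: lborel_prod measurable_completion)
  have ae1: "AE z in lebesgue. (case z of (x, y) \<Rightarrow> f x * g y * kernel_j (x - y))
      = (case z of (x, y) \<Rightarrow> F x * G y * kernel_j (x - y))"
    using AE_lebesgue_fst[OF fF] AE_lebesgue_snd[OF gG] by eventually_elim auto
  have ae2: "AE z in lebesgue. (case z of (x, y) \<Rightarrow> g x * f y * kernel_j (x - y))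
      = (case z of (x, y) \<Rightarrow> G x * F y * kernel_j (x - y))"
    using AE_lebesgue_fst[OF gG] AE_lebesgue_snd[OF fF] by eventually_elim auto
  have FG': "integrable lebesgue (\<lambda>(x, y). F x * G y * kernel_j (x - y))"
    using FG by (simp add: lborel_prod integrable_completion)
  then show "integrable lebesgue (\<lambda>(x, y). f x * g y * kernel_j (x - y))"
    using integrable_cong_AE[OF mfg mFG' ae1] by simp
  have "(\<integral>(x, y). f x * g y * kernel_j (x - y) \<partial>lebesgue)
      = (\<integral>(x, y). F x * G y * kernel_j (x - y) \<partial>lebesgue)"
    by (rule integral_cong_AE[OF mfg mFG' ae1])
  also have "\<dots> = (\<integral>(x, y). F x * G y * kernel_j (x - y) \<partial>(lborel \<Otimes>\<^sub>M lborel))"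
    using mF by (simp add: lborel_prod integral_completion)
  also have "\<dots> = (\<integral>(x, y). G x * F y * kernel_j (x - y) \<partial>(lborel \<Otimes>\<^sub>M lborel))"
    using lborel_pair.integral_product_swap[OF mG]
    by (simp add: kernel_j_minus_commute mult.commute mult.left_commute)
  also have "\<dots> = (\<integral>(x, y). G x * F y * kernel_j (x - y) \<partial>lebesgue)"
    using mG by (simp add: lborel_prod integral_completion)
  also have "\<dots> = (\<integral>(x, y). g x * f y * kernel_j (x - y) \<partial>lebesgue)"
    by (rule integral_cong_AE[OF mgf mGF' ae2, symmetric])
  finally show "(\<integral>(x, y). f x * g y * kernel_j (x - y) \<partial>lebesgue)
        = (\<integral>(x, y). g x * f y * kernel_j (x - y) \<partial>lebesgue)" .
qed

section \<open>The form domain\<close>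

lemma H_spaceD:
  assumes "u \<in> H_space \<Omega>"
  shows "u \<in> borel_measurable lebesgue" and "x \<notin> \<Omega> \<Longrightarrow> u x = 0"
  using assms by (auto simp: H_space_def)

lemma H_space_integrable_square:
  assumes u: "u \<in> H_space \<Omega>"
  shows "integrable lebesgue (\<lambda>x. (u x)\<^sup>2)"
proof -
  have "integrable lebesgue (\<lambda>x. indicator \<Omega> x *\<^sub>R (u x)\<^sup>2)"
    using u by (simp add: H_space_def set_integrable_def)
  also have "(\<lambda>x. indicator \<Omega> x *\<^sub>R (u x)\<^sup>2) = (\<lambda>x. (u x)\<^sup>2)"
    using H_spaceD(2)[OF u] by (auto simp: fun_eq_iff indicator_def)
  finally show ?thesis .
qed

lemma abs_mult_le_sum_squares: "\<bar>a * b\<bar> \<le> a\<^sup>2 + b\<^sup>2" for a b :: real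
proof -
  have "2 * (\<bar>a\<bar> * \<bar>b\<bar>) \<le> a\<^sup>2 + b\<^sup>2" "0 \<le> \<bar>a\<bar> * \<bar>b\<bar>"
    using sum_squares_bound[of "\<bar>a\<bar>" "\<bar>b\<bar>"] by (simp_all add: mult.assoc)
  then show ?thesis unfolding abs_mult by linarith
qed

lemma H_space_integrable_mult:
  assumes u: "u \<in> H_space \<Omega>" and v: "v \<in> H_space \<Omega>"
  shows "integrable lebesgue (\<lambda>x. u x * v x)"
proof (rule Bochner_Integration.integrable_bound)
  show "integrable lebesgue (\<lambda>x. (u x)\<^sup>2 + (v x)\<^sup>2)"
    by (intro Bochner_Integration.integrable_add H_space_integrable_square[OF u]
        H_space_integrable_square[OF v])
  show "(\<lambda>x. u x * v x) \<in> borel_measurable lebesgue"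
    by (intro borel_measurable_times H_spaceD(1)[OF u] H_spaceD(1)[OF v])
  show "AE x in lebesgue. norm (u x * v x) \<le> norm ((u x)\<^sup>2 + (v x)\<^sup>2)"
    by (simp add: abs_mult_le_sum_squares)
qed

lemma H_space_set_integral_mult:
  assumes "u \<in> H_space \<Omega>"
  shows "(\<integral>x\<in>\<Omega>. u x * w x \<partial>lebesgue) = (\<integral>x. u x * w x \<partial>lebesgue)"
  unfolding set_lebesgue_integral_def
  by (rule Bochner_Integration.integral_cong) (use H_spaceD(2)[OF assms] in \<open>auto simp: indicator_def\<close>)

lemma L2_norm_on_H_space:
  assumes "u \<in> H_space \<Omega>"
  shows "L2_norm_on \<Omega> u = sqrt (\<integral>x. u x * u x \<partial>lebesgue)"
  using H_space_set_integral_mult[OF assms, of u] by (simp add: L2_norm_on_def power2_eq_square)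

lemma H_space_integrable:
  assumes \<Omega>: "\<Omega> \<in> lmeasurable" and u: "u \<in> H_space \<Omega>"
  shows "integrable lebesgue u"
proof (rule Bochner_Integration.integrable_bound)
  show "integrable lebesgue (\<lambda>x. (u x)\<^sup>2 + indicator \<Omega> x)"
    using \<Omega> by (intro Bochner_Integration.integrable_add H_space_integrable_square[OF u])
      (auto simp: fmeasurable_def)
  have "\<bar>a\<bar> \<le> a\<^sup>2 + 1" for a :: real
    using abs_mult_le_sum_squares[of a 1] by simp
  then show "AE x in lebesgue. norm (u x) \<le> norm ((u x)\<^sup>2 + indicator \<Omega> x)"
    using H_spaceD(2)[OF u] by (auto simp: indicator_def)
qed (use H_spaceD(1)[OF u] in simp)

lemma H_space_measurable_energy:
  assumes u: "u \<in> borel_measurable lebesgue" and v: "v \<in> borel_measurable lebesgue"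
  shows "(\<lambda>(x, y). (u x - u y) * (v x - v y) * kernel_k (x - y)) \<in> borel_measurable lebesgue"
  unfolding split_beta'
  by (intro borel_measurable_times borel_measurable_diff borel_measurable_lebesgue_fst[OF u]
      borel_measurable_lebesgue_snd[OF u] borel_measurable_lebesgue_fst[OF v]
      borel_measurable_lebesgue_snd[OF v] borel_measurable_lebesgue_diff_arg
      borel_measurable_kernel_k)

lemma H_space_integrable_self_energy:
  assumes u: "u \<in> H_space \<Omega>"
  shows "integrable lebesgue (\<lambda>(x, y). (u x - u y) * (u x - u y) * kernel_k (x - y))"
proof (rule integrableI_bounded)
  show "(\<lambda>(x, y). (u x - u y) * (u x - u y) * kernel_k (x - y)) \<in> borel_measurable lebesgue"
    by (intro H_space_measurable_energy H_spaceD(1)[OF u])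
  have "ennreal (norm (case z of (x, y) \<Rightarrow> (u x - u y) * (u x - u y) * kernel_k (x - y)))
      = (case z of (x, y) \<Rightarrow> ennreal (\<bar>u x - u y\<bar>\<^sup>2 * kernel_k (x - y)))" for z
    by (auto simp: split_beta abs_mult kernel_k_nonneg power2_eq_square)
  then show "(\<integral>\<^sup>+ z. ennreal (norm (case z of (x, y) \<Rightarrow> (u x - u y) * (u x - u y) * kernel_k (x - y)))
      \<partial>lebesgue) < \<infinity>"
    using u by (simp add: H_space_def)
qed

lemma H_space_integrable_energy:
  assumes u: "u \<in> H_space \<Omega>" and v: "v \<in> H_space \<Omega>"
  shows "integrable lebesgue (\<lambda>(x, y). (u x - u y) * (v x - v y) * kernel_k (x - y))"
proof (rule Bochner_Integration.integrable_bound)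
  show "integrable lebesgue (\<lambda>z. (case z of (x, y) \<Rightarrow> (u x - u y) * (u x - u y) * kernel_k (x - y))
      + (case z of (x, y) \<Rightarrow> (v x - v y) * (v x - v y) * kernel_k (x - y)))"
    by (intro Bochner_Integration.integrable_add H_space_integrable_self_energy[OF u]
        H_space_integrable_self_energy[OF v])
  show "(\<lambda>(x, y). (u x - u y) * (v x - v y) * kernel_k (x - y)) \<in> borel_measurable lebesgue"
    by (intro H_space_measurable_energy H_spaceD(1)[OF u] H_spaceD(1)[OF v])
  have "\<bar>a * b * k\<bar> \<le> \<bar>a * a * k + b * b * k\<bar>" if "0 \<le> k" for a b k :: real
  proof -
    have "\<bar>a * b\<bar> \<le> a * a + b * b"
      using abs_mult_le_sum_squares[of a b] by (simp add: power2_eq_square)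
    from mult_right_mono[OF this that] show ?thesis
      using that by (simp add: abs_mult distrib_right)
  qed
  then show "AE z in lebesgue. norm (case z of (x, y) \<Rightarrow> (u x - u y) * (v x - v y) * kernel_k (x - y))
      \<le> norm ((case z of (x, y) \<Rightarrow> (u x - u y) * (u x - u y) * kernel_k (x - y))
      + (case z of (x, y) \<Rightarrow> (v x - v y) * (v x - v y) * kernel_k (x - y)))"
    by (simp add: split_beta kernel_k_nonneg)
qed

text \<open>All memberships in the form domain below are instances of this lemma. Comparing with a
  point \<open>y \<notin> \<Omega>\<close>, where everything vanishes, turns the bound on differences into a pointwise bound,
  so that square integrability comes for free.\<close>

lemma H_space_lipschitz:
  assumes u: "u \<in> H_space \<Omega>" and v: "v \<in> H_space \<Omega>"
    and w: "w \<in> borel_measurable lebesgue" and w0: "\<And>x. x \<notin> \<Omega> \<Longrightarrow> w x = 0"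
    and lip: "\<And>x y. \<bar>w x - w y\<bar> \<le> A * \<bar>u x - u y\<bar> + B * \<bar>v x - v y\<bar>"
    and \<Omega>: "\<Omega> \<noteq> UNIV"
  shows "w \<in> H_space \<Omega>"
proof -
  have sq: "c\<^sup>2 \<le> 2 * A\<^sup>2 * (a * a) + 2 * B\<^sup>2 * (b * b)" if "\<bar>c\<bar> \<le> A * \<bar>a\<bar> + B * \<bar>b\<bar>" for a b c :: real
  proof -
    have "c\<^sup>2 = \<bar>c\<bar>\<^sup>2" by simp
    also have "\<dots> \<le> (A * \<bar>a\<bar> + B * \<bar>b\<bar>)\<^sup>2" using that by (intro power_mono) auto
    also have "\<dots> \<le> 2 * (A * \<bar>a\<bar>)\<^sup>2 + 2 * (B * \<bar>b\<bar>)\<^sup>2"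
      using sum_squares_bound[of "A * \<bar>a\<bar>" "B * \<bar>b\<bar>"] by (simp add: power2_sum)
    also have "\<dots> = 2 * A\<^sup>2 * (a * a) + 2 * B\<^sup>2 * (b * b)"
      by (simp add: power_mult_distrib flip: power2_eq_square)
    finally show ?thesis .
  qed
  obtain o' where o': "o' \<notin> \<Omega>" using \<Omega> by auto
  have bd: "\<bar>w x\<bar> \<le> A * \<bar>u x\<bar> + B * \<bar>v x\<bar>" for x
    using lip[of x o'] w0[OF o'] H_spaceD(2)[OF u o'] H_spaceD(2)[OF v o'] by simp
  have int: "integrable lebesgue (\<lambda>x. (w x)\<^sup>2)"
  proof (rule Bochner_Integration.integrable_bound)
    show "integrable lebesgue (\<lambda>x. 2 * A\<^sup>2 * (u x * u x) + 2 * B\<^sup>2 * (v x * v x))"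
      by (intro Bochner_Integration.integrable_add integrable_mult_right
          H_space_integrable_mult[OF u u] H_space_integrable_mult[OF v v])
    show "(\<lambda>x. (w x)\<^sup>2) \<in> borel_measurable lebesgue"
      using w by simp
    show "AE x in lebesgue. norm ((w x)\<^sup>2) \<le> norm (2 * A\<^sup>2 * (u x * u x) + 2 * B\<^sup>2 * (v x * v x))"
      using sq[OF bd] by (intro AE_I2) (auto intro: order_trans[OF _ abs_ge_self])
  qed
  have "(\<lambda>x. indicator \<Omega> x *\<^sub>R (w x)\<^sup>2) = (\<lambda>x. (w x)\<^sup>2)"
    using w0 by (auto simp: fun_eq_iff indicator_def)
  then have si: "set_integrable lebesgue \<Omega> (\<lambda>x. (w x)\<^sup>2)"
    using int by (simp add: set_integrable_def)
  have "integrable lebesgue (\<lambda>(x, y). (w x - w y) * (w x - w y) * kernel_k (x - y))"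
  proof (rule Bochner_Integration.integrable_bound)
    show "integrable lebesgue (\<lambda>z.
        2 * A\<^sup>2 * (case z of (x, y) \<Rightarrow> (u x - u y) * (u x - u y) * kernel_k (x - y))
        + 2 * B\<^sup>2 * (case z of (x, y) \<Rightarrow> (v x - v y) * (v x - v y) * kernel_k (x - y)))"
      by (intro Bochner_Integration.integrable_add integrable_mult_right
          H_space_integrable_self_energy[OF u] H_space_integrable_self_energy[OF v])
    show "(\<lambda>(x, y). (w x - w y) * (w x - w y) * kernel_k (x - y)) \<in> borel_measurable lebesgue"
      by (intro H_space_measurable_energy w)
    have "\<bar>(w x - w y) * (w x - w y) * kernel_k (x - y)\<bar>
      \<le> \<bar>2 * A\<^sup>2 * ((u x - u y) * (u x - u y) * kernel_k (x - y))
        + 2 * B\<^sup>2 * ((v x - v y) * (v x - v y) * kernel_k (x - y))\<bar>" for x y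
      using mult_right_mono[OF sq[OF lip[of x y]] kernel_k_nonneg[of "x - y"]]
      by (simp add: abs_mult kernel_k_nonneg power2_eq_square distrib_right mult.assoc)
    then show "AE z in lebesgue. norm (case z of (x, y) \<Rightarrow> (w x - w y) * (w x - w y) * kernel_k (x - y))
      \<le> norm (2 * A\<^sup>2 * (case z of (x, y) \<Rightarrow> (u x - u y) * (u x - u y) * kernel_k (x - y))
        + 2 * B\<^sup>2 * (case z of (x, y) \<Rightarrow> (v x - v y) * (v x - v y) * kernel_k (x - y)))"
      by (simp add: split_beta)
  qed
  then have fin: "(\<integral>\<^sup>+ z. ennreal (norm (case z of (x, y) \<Rightarrow> (w x - w y) * (w x - w y) * kernel_k (x - y)))
      \<partial>lebesgue) < \<infinity>"
    by (simp only: integrable_iff_bounded)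
  have "ennreal (norm (case z of (x, y) \<Rightarrow> (w x - w y) * (w x - w y) * kernel_k (x - y)))
      = (case z of (x, y) \<Rightarrow> ennreal (\<bar>w x - w y\<bar>\<^sup>2 * kernel_k (x - y)))" for z
    by (auto simp: split_beta abs_mult kernel_k_nonneg power2_eq_square)
  then have "(\<integral>\<^sup>+ (x, y). ennreal (\<bar>w x - w y\<bar>\<^sup>2 * kernel_k (x - y)) \<partial>lebesgue) < \<infinity>"
    using fin by simp
  then show ?thesis
    using w w0 si by (simp add: H_space_def)
qed

lemma H_space_scale:
  assumes u: "u \<in> H_space \<Omega>" and \<Omega>: "\<Omega> \<noteq> UNIV"
  shows "(\<lambda>x. a * u x) \<in> H_space \<Omega>"
proof (rule H_space_lipschitz[OF u u _ _ _ \<Omega>])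
  show "(\<lambda>x. a * u x) \<in> borel_measurable lebesgue"
    using H_spaceD(1)[OF u] by simp
  show "\<bar>a * u x - a * u y\<bar> \<le> \<bar>a\<bar> * \<bar>u x - u y\<bar> + 0 * \<bar>u x - u y\<bar>" for x y
    by (simp flip: abs_mult right_diff_distrib)
qed (use H_spaceD(2)[OF u] in simp)

lemma H_space_abs:
  assumes u: "u \<in> H_space \<Omega>" and \<Omega>: "\<Omega> \<noteq> UNIV"
  shows "(\<lambda>x. \<bar>u x\<bar>) \<in> H_space \<Omega>"
proof (rule H_space_lipschitz[OF u u _ _ _ \<Omega>])
  show "(\<lambda>x. \<bar>u x\<bar>) \<in> borel_measurable lebesgue"
    using H_spaceD(1)[OF u] by simp
  show "\<bar>\<bar>u x\<bar> - \<bar>u y\<bar>\<bar> \<le> 1 * \<bar>u x - u y\<bar> + 0 * \<bar>u x - u y\<bar>" for x y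
    by simp
qed (use H_spaceD(2)[OF u] in simp)

lemma form_EL_scale: "form_EL (\<lambda>x. a * u x) w = a * form_EL u w"
proof -
  have "form_E (\<lambda>x. a * u x) w = c_const DIM('a) / 2 *
     (\<integral>z. a * (case z of (x, y) \<Rightarrow> (u x - u y) * (w x - w y) * kernel_k (x - y)) \<partial>lebesgue)"
    unfolding form_E_def
    by (intro arg_cong2[where f = "(*)"] Bochner_Integration.integral_cong refl)
      (simp add: split_beta algebra_simps)
  then have E: "form_E (\<lambda>x. a * u x) w = a * form_E u w"
    by (simp add: form_E_def)
  have "(\<integral>(x, y). a * u x * w y * kernel_j (x - y) \<partial>lebesgue) =
     (\<integral>z. a * (case z of (x, y) \<Rightarrow> u x * w y * kernel_j (x - y)) \<partial>lebesgue)"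
    by (intro Bochner_Integration.integral_cong refl) (simp add: split_beta algebra_simps)
  then have J: "(\<integral>(x, y). a * u x * w y * kernel_j (x - y) \<partial>lebesgue) =
     a * (\<integral>(x, y). u x * w y * kernel_j (x - y) \<partial>lebesgue)"
    by simp
  show ?thesis
    unfolding form_EL_def E J by (simp add: algebra_simps)
qed

lemma form_EL_cong_AE:
  fixes u v w :: "'a::euclidean_space \<Rightarrow> real"
  assumes u: "u \<in> H_space \<Omega>" and v: "v \<in> H_space \<Omega>" and w: "w \<in> H_space \<Omega>"
    and uv: "AE x in lebesgue. u x = v x"
  shows "form_EL u w = form_EL v w"
proof -
  note m = H_spaceD(1)[OF u] H_spaceD(1)[OF v] H_spaceD(1)[OF w]
  have mj: "(\<lambda>(x, y). f x * w y * kernel_j (x - y)) \<in> borel_measurable lebesgue"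
    if "f \<in> borel_measurable lebesgue" for f
    unfolding split_beta'
    by (intro borel_measurable_times borel_measurable_lebesgue_fst[OF that]
        borel_measurable_lebesgue_snd[OF m(3)] borel_measurable_lebesgue_diff_arg
        borel_measurable_kernel_j)
  have "form_E u w = form_E v w"
    unfolding form_E_def
    by (intro arg_cong2[where f = "(*)"] refl integral_cong_AE H_space_measurable_energy m)
      (use AE_lebesgue_fst[OF uv] AE_lebesgue_snd[OF uv] in \<open>eventually_elim, auto\<close>)
  moreover have "(\<integral>(x, y). u x * w y * kernel_j (x - y) \<partial>lebesgue)
      = (\<integral>(x, y). v x * w y * kernel_j (x - y) \<partial>lebesgue)"
    by (intro integral_cong_AE mj m) (use AE_lebesgue_fst[OF uv] in \<open>eventually_elim, auto\<close>)
  moreover have "(\<integral>x. u x * w x \<partial>lebesgue) = (\<integral>x. v x * w x \<partial>lebesgue)"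
    by (intro integral_cong_AE borel_measurable_times m) (use uv in \<open>eventually_elim, auto\<close>)
  ultimately show ?thesis by (simp add: form_EL_def)
qed

text \<open>This allows \<open>v \<ge> 0\<close> to be assumed at every point, so that the pointwise inequalities below
  need no exceptional sets.\<close>

lemma weak_solution_abs:
  assumes v: "weak_solution \<Omega> lam v" and nonneg: "AE x in lebesgue. 0 \<le> v x"
    and \<Omega>: "\<Omega> \<noteq> UNIV"
  shows "weak_solution \<Omega> lam (\<lambda>x. \<bar>v x\<bar>)"
proof -
  have vH: "v \<in> H_space \<Omega>" using v by (simp add: weak_solution_def)
  have aH: "(\<lambda>x. \<bar>v x\<bar>) \<in> H_space \<Omega>" by (rule H_space_abs[OF vH \<Omega>])
  have ae: "AE x in lebesgue. \<bar>v x\<bar> = v x" using nonneg by eventually_elim simp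
  show ?thesis
    unfolding weak_solution_def
  proof (intro conjI ballI aH)
    fix w assume w: "w \<in> H_space \<Omega>"
    have "form_EL (\<lambda>x. \<bar>v x\<bar>) w = form_EL v w"
      by (rule form_EL_cong_AE[OF aH vH w ae])
    also have "\<dots> = lam * (\<integral>x. v x * w x \<partial>lebesgue)"
      using v w by (simp add: weak_solution_def H_space_set_integral_mult[OF vH])
    also have "(\<integral>x. v x * w x \<partial>lebesgue) = (\<integral>x. \<bar>v x\<bar> * w x \<partial>lebesgue)"
      by (intro integral_cong_AE borel_measurable_times H_spaceD(1)[OF vH] H_spaceD(1)[OF aH]
          H_spaceD(1)[OF w]) (use ae in \<open>eventually_elim, auto\<close>)
    also have "\<dots> = (\<integral>x\<in>\<Omega>. \<bar>v x\<bar> * w x \<partial>lebesgue)"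
      by (rule H_space_set_integral_mult[OF aH, symmetric])
    finally show "form_EL (\<lambda>x. \<bar>v x\<bar>) w = lam * (\<integral>x\<in>\<Omega>. \<bar>v x\<bar> * w x \<partial>lebesgue)" .
  qed
qed

lemma weak_solution_uminus:
  assumes v: "weak_solution \<Omega> lam v" and \<Omega>: "\<Omega> \<noteq> UNIV"
  shows "weak_solution \<Omega> lam (\<lambda>x. - v x)"
proof -
  have vH: "v \<in> H_space \<Omega>" using v by (simp add: weak_solution_def)
  have mH: "(\<lambda>x. - v x) \<in> H_space \<Omega>" using H_space_scale[OF vH \<Omega>, of "-1"] by simp
  have "form_EL (\<lambda>x. - v x) w = lam * (\<integral>x\<in>\<Omega>. - v x * w x \<partial>lebesgue)" if "w \<in> H_space \<Omega>" for w
    unfolding H_space_set_integral_mult[OF mH]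
    using v that form_EL_scale[of "-1" v w]
    by (simp add: weak_solution_def H_space_set_integral_mult[OF vH])
  then show ?thesis
    using mH by (simp add: weak_solution_def)
qed

section \<open>Picone test functions\<close>

definition cut :: "nat \<Rightarrow> real \<Rightarrow> real" where
  "cut n t = max (- real (Suc n)) (min (real (Suc n)) t)"

lemma abs_cut_le: "\<bar>cut n t\<bar> \<le> real (Suc n)"
  by (auto simp: cut_def)

lemma abs_cut_le_abs: "\<bar>cut n t\<bar> \<le> \<bar>t\<bar>"
  by (auto simp: cut_def)

lemma cut_lipschitz: "\<bar>cut n s - cut n t\<bar> \<le> \<bar>s - t\<bar>"
  by (auto simp: cut_def max_def min_def)

lemma cut_0 [simp]: "cut n 0 = 0"
  by (simp add: cut_def)

lemma borel_measurable_cut [measurable]: "cut n \<in> borel_measurable borel"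
  unfolding cut_def by measurable

lemma cut_tendsto: "(\<lambda>n. cut n t) \<longlonglongrightarrow> t"
proof (rule tendsto_eventually)
  obtain N :: nat where N: "\<bar>t\<bar> < real N" using reals_Archimedean2 by blast
  show "\<forall>\<^sub>F n in sequentially. cut n t = t"
    using eventually_ge_at_top[of N] by eventually_elim (use N in \<open>auto simp: cut_def\<close>)
qed

text \<open>The truncation level \<open>n + 1\<close> and the shift \<open>1 / (n + 1)\<close> are coupled, so that a single passage
  to the limit removes both.\<close>

definition eps :: "nat \<Rightarrow> real" where
  "eps n = inverse (real (Suc n))"

lemma eps_pos: "0 < eps n"
  by (simp add: eps_def)

lemma eps_tendsto: "eps \<longlonglongrightarrow> 0"
  unfolding eps_def by (rule LIMSEQ_inverse_real_of_nat)

definition picone_test :: "('a \<Rightarrow> real) \<Rightarrow> ('a \<Rightarrow> real) \<Rightarrow> nat \<Rightarrow> 'a \<Rightarrow> real" where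
  "picone_test v u n x = (cut n (u x))\<^sup>2 / (v x + eps n)"

lemma quotient_square_lipschitz:
  fixes a b p q :: real
  assumes "\<bar>a\<bar> \<le> M" "\<bar>b\<bar> \<le> M" and e: "0 < e" "e \<le> p" "e \<le> q"
  shows "\<bar>a\<^sup>2 / p - b\<^sup>2 / q\<bar> \<le> 2 * M / e * \<bar>a - b\<bar> + M\<^sup>2 / e\<^sup>2 * \<bar>p - q\<bar>"
proof -
  have M: "0 \<le> M" using assms by linarith
  have pq: "0 < p" "0 < q" using e by auto
  have "a\<^sup>2 / p - b\<^sup>2 / q = (a + b) * (a - b) / p + b\<^sup>2 * (q - p) / (p * q)"
    using pq by (simp add: field_simps power2_eq_square)
  also have "\<bar>\<dots>\<bar> \<le> \<bar>(a + b) * (a - b) / p\<bar> + \<bar>b\<^sup>2 * (q - p) / (p * q)\<bar>"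
    by (rule abs_triangle_ineq)
  also have "\<bar>(a + b) * (a - b) / p\<bar> = \<bar>a + b\<bar> / p * \<bar>a - b\<bar>"
    using pq by (simp add: abs_mult)
  also have "\<dots> \<le> 2 * M / e * \<bar>a - b\<bar>"
    using assms pq by (intro mult_right_mono frac_le) auto
  also have "\<bar>b\<^sup>2 * (q - p) / (p * q)\<bar> = \<bar>b\<bar>\<^sup>2 / (p * q) * \<bar>p - q\<bar>"
    using pq by (simp add: abs_mult abs_minus_commute)
  also have "\<dots> \<le> M\<^sup>2 / e\<^sup>2 * \<bar>p - q\<bar>"
  proof (intro mult_right_mono frac_le)
    show "\<bar>b\<bar>\<^sup>2 \<le> M\<^sup>2" using assms by (intro power_mono) auto
    show "e\<^sup>2 \<le> p * q" unfolding power2_eq_square using e by (intro mult_mono) auto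
  qed (use e in auto)
  finally show ?thesis by simp
qed

lemma picone_test_H_space:
  assumes u: "u \<in> H_space \<Omega>" and v: "v \<in> H_space \<Omega>" and nonneg: "\<And>x. 0 \<le> v x"
    and \<Omega>: "\<Omega> \<noteq> UNIV"
  shows "picone_test v u n \<in> H_space \<Omega>"
proof (rule H_space_lipschitz[OF u v _ _ _ \<Omega>])
  have [measurable]: "u \<in> borel_measurable lebesgue" "v \<in> borel_measurable lebesgue"
    using H_spaceD(1)[OF u] H_spaceD(1)[OF v] .
  have "(\<lambda>x. (cut n (u x))\<^sup>2 / (v x + eps n)) \<in> borel_measurable lebesgue"
    by measurable
  then show "picone_test v u n \<in> borel_measurable lebesgue"
    by (simp add: picone_test_def[abs_def])
  fix x y
  have "\<bar>picone_test v u n x - picone_test v u n y\<bar>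
      \<le> 2 * real (Suc n) / eps n * \<bar>cut n (u x) - cut n (u y)\<bar>
        + (real (Suc n))\<^sup>2 / (eps n)\<^sup>2 * \<bar>(v x + eps n) - (v y + eps n)\<bar>"
    unfolding picone_test_def
    by (intro quotient_square_lipschitz abs_cut_le eps_pos) (use nonneg in auto)
  also have "\<dots> \<le> 2 * real (Suc n) / eps n * \<bar>u x - u y\<bar> + (real (Suc n))\<^sup>2 / (eps n)\<^sup>2 * \<bar>v x - v y\<bar>"
    using eps_pos[of n] by (intro add_mono mult_left_mono cut_lipschitz) auto
  finally show "\<bar>picone_test v u n x - picone_test v u n y\<bar>
      \<le> 2 * real (Suc n) / eps n * \<bar>u x - u y\<bar> + (real (Suc n))\<^sup>2 / (eps n)\<^sup>2 * \<bar>v x - v y\<bar>" .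
next
  show "x \<notin> \<Omega> \<Longrightarrow> picone_test v u n x = 0" for x
    using H_spaceD(2)[OF u] by (simp add: picone_test_def)
qed

lemma cut_H_space:
  assumes u: "u \<in> H_space \<Omega>" and \<Omega>: "\<Omega> \<noteq> UNIV"
  shows "(\<lambda>x. cut n (u x)) \<in> H_space \<Omega>"
proof (rule H_space_lipschitz[OF u u _ _ _ \<Omega>])
  have [measurable]: "u \<in> borel_measurable lebesgue"
    by (rule H_spaceD(1)[OF u])
  show "(\<lambda>x. cut n (u x)) \<in> borel_measurable lebesgue"
    by measurable
  show "\<bar>cut n (u x) - cut n (u y)\<bar> \<le> 1 * \<bar>u x - u y\<bar> + 0 * \<bar>u x - u y\<bar>" for x y
    using cut_lipschitz[of n "u x" "u y"] by simp
qed (use H_spaceD(2)[OF u] in simp)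

text \<open>The slack in Picone's inequality. By the next lemma it is the square of
  \<open>a (q/p)\<^sup>1\<^sup>/\<^sup>2 - b (p/q)\<^sup>1\<^sup>/\<^sup>2\<close>, where \<open>a, b\<close> are the truncated values of \<open>u\<close> at \<open>x, y\<close> and \<open>p, q\<close> are the
  values of \<open>v + \<epsilon>\<close>.\<close>

definition picone_deficit :: "('a \<Rightarrow> real) \<Rightarrow> ('a \<Rightarrow> real) \<Rightarrow> nat \<Rightarrow> 'a \<Rightarrow> 'a \<Rightarrow> real" where
  "picone_deficit v u n x y = (cut n (u x) - cut n (u y)) * (cut n (u x) - cut n (u y))
     - (v x - v y) * (picone_test v u n x - picone_test v u n y)"

lemma picone_deficit_eq:
  assumes "\<And>x. 0 \<le> v x"
  shows "picone_deficit v u n x y = (cut n (u x))\<^sup>2 * ((v y + eps n) / (v x + eps n))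
     + (cut n (u y))\<^sup>2 * ((v x + eps n) / (v y + eps n)) - 2 * cut n (u x) * cut n (u y)"
proof -
  have *: "(a - b) * (a - b) - ((p - e) - (q - e)) * (a\<^sup>2 / p - b\<^sup>2 / q)
      = a\<^sup>2 * (q / p) + b\<^sup>2 * (p / q) - 2 * a * b"
    if "0 < p" "0 < q" for a b p q e :: real
    using that by (simp add: field_simps power2_eq_square)
  have "0 < v x + eps n" "0 < v y + eps n"
    using assms[of x] assms[of y] eps_pos[of n] by linarith+
  from *[OF this, of "cut n (u x)" "cut n (u y)" "eps n"] show ?thesis
    by (simp add: picone_deficit_def picone_test_def)
qed

lemma picone_deficit_nonneg:
  assumes "\<And>x. 0 \<le> v x"
  shows "0 \<le> picone_deficit v u n x y"
proof -
  have *: "0 \<le> a\<^sup>2 * (q / p) + b\<^sup>2 * (p / q) - 2 * a * b"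
    if pq: "0 < p" "0 < q" for a b p q :: real
  proof -
    have "a\<^sup>2 * (q / p) + b\<^sup>2 * (p / q) - 2 * a * b = (a * q - b * p)\<^sup>2 / (p * q)"
      using that by (simp add: field_simps power2_eq_square)
    then show ?thesis using that by simp
  qed
  have "0 < v x + eps n" "0 < v y + eps n"
    using assms[of x] assms[of y] eps_pos[of n] by linarith+
  from *[OF this] show ?thesis
    by (simp add: picone_deficit_eq[OF assms])
qed

lemma mult_picone_test_bounds:
  assumes "\<And>x. 0 \<le> v x"
  shows "0 \<le> v x * picone_test v u n x" and "v x * picone_test v u n x \<le> (u x)\<^sup>2"
proof -
  have e: "0 < v x + eps n" "0 \<le> v x" using assms[of x] eps_pos[of n] by linarith+
  show "0 \<le> v x * picone_test v u n x"
    using e by (simp add: picone_test_def)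
  have "v x * picone_test v u n x = v x / (v x + eps n) * (cut n (u x))\<^sup>2"
    by (simp add: picone_test_def)
  also have "\<dots> \<le> 1 * (u x)\<^sup>2"
  proof (intro mult_mono)
    show "v x / (v x + eps n) \<le> 1" using e eps_pos[of n] by simp
    show "(cut n (u x))\<^sup>2 \<le> (u x)\<^sup>2"
      using abs_cut_le_abs[of n "u x"] by (simp add: abs_le_square_iff)
  qed auto
  finally show "v x * picone_test v u n x \<le> (u x)\<^sup>2" by simp
qed

text \<open>The weak equation tested with \<open>\<phi> = picone_test v u n\<close>, rewritten through the deficit. With
  the energy of the truncation of \<open>u\<close> on the right it is an identity, and truncation does not
  increase the energy. The strong maximum principle exploits the size of the deficit; the lower
  bound for the form only its sign.\<close>

lemma picone_energy:
  fixes u v :: "'a::euclidean_space \<Rightarrow> real"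
  assumes sol: "weak_solution \<Omega> lam v" and nonneg: "\<And>x. 0 \<le> v x"
    and u: "u \<in> H_space \<Omega>" and \<Omega>: "\<Omega> \<noteq> UNIV"
  shows "integrable lebesgue (\<lambda>(x, y). picone_deficit v u n x y * kernel_k (x - y))" (is ?int)
    and "c_const DIM('a) / 2 * (\<integral>(x, y). picone_deficit v u n x y * kernel_k (x - y) \<partial>lebesgue)
      + c_const DIM('a) * (\<integral>(x, y). v x * picone_test v u n y * kernel_j (x - y) \<partial>lebesgue)
      + (lam - rho_const DIM('a)) * (\<integral>x. v x * picone_test v u n x \<partial>lebesgue)
      \<le> form_E u u" (is "?lhs \<le> _")
proof -
  define w where "w = picone_test v u n"
  define t where "t = (\<lambda>x. cut n (u x))"
  have v: "v \<in> H_space \<Omega>" using sol by (simp add: weak_solution_def)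
  have w: "w \<in> H_space \<Omega>"
    unfolding w_def by (rule picone_test_H_space[OF u v nonneg \<Omega>])
  have t: "t \<in> H_space \<Omega>"
    unfolding t_def by (rule cut_H_space[OF u \<Omega>])
  note it = H_space_integrable_energy[OF t t] and iv = H_space_integrable_energy[OF v w]
  have D: "(\<lambda>(x, y). picone_deficit v u n x y * kernel_k (x - y))
      = (\<lambda>z. (case z of (x, y) \<Rightarrow> (t x - t y) * (t x - t y) * kernel_k (x - y))
           - (case z of (x, y) \<Rightarrow> (v x - v y) * (w x - w y) * kernel_k (x - y)))"
    by (auto simp: picone_deficit_def w_def t_def algebra_simps)
  show ?int
    unfolding D by (intro Bochner_Integration.integrable_diff it iv)
  have "c_const DIM('a) / 2 * (\<integral>(x, y). picone_deficit v u n x y * kernel_k (x - y) \<partial>lebesgue)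
      = form_E t t - form_E v w"
    unfolding D form_E_def
    by (subst Bochner_Integration.integral_diff[OF it iv]) (simp add: right_diff_distrib)
  moreover have "form_EL v w = lam * (\<integral>x. v x * w x \<partial>lebesgue)"
    using sol w by (simp add: weak_solution_def H_space_set_integral_mult[OF v])
  ultimately have "?lhs = form_E t t"
    by (simp add: form_EL_def w_def[symmetric] algebra_simps)
  also have "form_E t t \<le> form_E u u"
    unfolding form_E_def
  proof (intro mult_left_mono integral_mono it H_space_integrable_energy[OF u u])
    fix z :: "'a \<times> 'a"
    have "(t x - t y) * (t x - t y) \<le> (u x - u y) * (u x - u y)" for x y
      using cut_lipschitz[of n "u x" "u y"]
      by (simp add: t_def abs_le_square_iff power2_eq_square)
    then show "(case z of (x, y) \<Rightarrow> (t x - t y) * (t x - t y) * kernel_k (x - y))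
        \<le> (case z of (x, y) \<Rightarrow> (u x - u y) * (u x - u y) * kernel_k (x - y))"
      by (auto simp: split_beta intro!: mult_right_mono kernel_k_nonneg)
  qed (simp add: c_const_pos less_imp_le)
  finally show "?lhs \<le> form_E u u" .
qed

section \<open>The zero set of a nonnegative solution\<close>

text \<open>A strong maximum principle in weak form. In the inequality \<open>picone_energy\<close> the term
  \<open>\<integral> v \<phi>\<close> stays between \<open>0\<close> and \<open>\<integral> u\<^sup>2\<close>, which bounds the integrals of the nonnegative functions
  \<open>G n\<close> collecting the two double integrals. Hence \<open>eps n * G n\<close> tends to \<open>0\<close> in \<open>L\<^sup>1\<close>, and almost
  everywhere along a subsequence. At a pair with \<open>v(x) > 0 = v(y)\<close> its pointwise limit is
  \<open>u(y)\<^sup>2 v(x)\<close> times a positive kernel, so \<open>u(y) = 0\<close> for almost all such pairs.\<close>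

lemma vanishes_on_zero_set:
  fixes u v :: "'a::euclidean_space \<Rightarrow> real"
  assumes sol: "weak_solution \<Omega> lam v" and nonneg: "\<And>x. 0 \<le> v x" and nontriv: "nontrivial v"
    and u: "u \<in> H_space \<Omega>" and \<Omega>: "\<Omega> \<noteq> UNIV" "\<Omega> \<in> lmeasurable"
  shows "AE x in lebesgue. v x = 0 \<longrightarrow> u x = 0"
proof -
  define c where "c = c_const DIM('a)"
  have c: "0 < c" by (simp add: c_def c_const_pos)
  have v: "v \<in> H_space \<Omega>" using sol by (simp add: weak_solution_def)
  have w: "picone_test v u n \<in> H_space \<Omega>" for n
    by (rule picone_test_H_space[OF u v nonneg \<Omega>(1)])
  define G :: "nat \<Rightarrow> 'a \<times> 'a \<Rightarrow> real" where "G = (\<lambda>n z.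
    (case z of (x, y) \<Rightarrow> picone_deficit v u n x y * kernel_k (x - y)) / 2
    + (case z of (x, y) \<Rightarrow> v x * picone_test v u n y * kernel_j (x - y)))"
  have G_nonneg: "0 \<le> G n z" for n z
    using nonneg eps_pos[of n]
    by (auto simp: G_def split_beta picone_test_def kernel_k_nonneg kernel_j_nonneg
        picone_deficit_nonneg add_nonneg_nonneg less_imp_le intro!: add_nonneg_nonneg mult_nonneg_nonneg)
  note iD = picone_energy(1)[OF sol nonneg u \<Omega>(1)]
  have iJ: "integrable lebesgue (\<lambda>(x, y). v x * picone_test v u n y * kernel_j (x - y))" for n
    by (intro integrable_tensor_kernel_j H_space_integrable[OF \<Omega>(2)] v w)
  have G_int: "integrable lebesgue (G n)" for n
    unfolding G_def by (intro Bochner_Integration.integrable_add integrable_divide_zero iD iJ)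
  define K where "K = form_E u u + \<bar>lam - rho_const DIM('a)\<bar> * (\<integral>x. (u x)\<^sup>2 \<partial>lebesgue)"
  have G_le: "(\<integral>z. G n z \<partial>lebesgue) \<le> K / c" for n
  proof -
    define I where "I = (\<integral>x. v x * picone_test v u n x \<partial>lebesgue)"
    have "0 \<le> I" "I \<le> (\<integral>x. (u x)\<^sup>2 \<partial>lebesgue)"
      unfolding I_def
      by (auto intro!: integral_mono Bochner_Integration.integral_nonneg
          H_space_integrable_mult[OF v w] H_space_integrable_square[OF u]
          mult_picone_test_bounds nonneg)
    then have "\<bar>(lam - rho_const DIM('a)) * I\<bar>
        \<le> \<bar>lam - rho_const DIM('a)\<bar> * (\<integral>x. (u x)\<^sup>2 \<partial>lebesgue)"
      unfolding abs_mult by (intro mult_left_mono) auto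
    moreover have "c * (\<integral>z. G n z \<partial>lebesgue) + (lam - rho_const DIM('a)) * I \<le> form_E u u"
      using picone_energy(2)[OF sol nonneg u \<Omega>(1), of n]
      unfolding G_def
      by (subst Bochner_Integration.integral_add[OF integrable_divide_zero[OF iD] iJ])
        (simp_all add: c_def I_def algebra_simps)
    ultimately have "c * (\<integral>z. G n z \<partial>lebesgue) \<le> K"
      unfolding K_def by linarith
    then show ?thesis using c by (simp add: field_simps)
  qed
  have "(\<lambda>n. \<integral>z. norm (eps n * G n z) \<partial>lebesgue) \<longlonglongrightarrow> 0"
  proof (rule tendsto_sandwich[where f = "\<lambda>_. 0"])
    show "\<forall>\<^sub>F n in sequentially. (\<integral>z. norm (eps n * G n z) \<partial>lebesgue) \<le> eps n * (K / c)"
    proof (intro always_eventually allI)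
      fix n
      have "(\<integral>z. norm (eps n * G n z) \<partial>lebesgue) = eps n * (\<integral>z. G n z \<partial>lebesgue)"
        using G_nonneg eps_pos[of n] by (simp add: abs_mult)
      also have "\<dots> \<le> eps n * (K / c)"
        using G_le eps_pos[of n] by (intro mult_left_mono) auto
      finally show "(\<integral>z. norm (eps n * G n z) \<partial>lebesgue) \<le> eps n * (K / c)" .
    qed
    have "(\<lambda>n. eps n * (K / c)) \<longlonglongrightarrow> 0 * (K / c)"
      by (intro tendsto_intros eps_tendsto)
    then show "(\<lambda>n. eps n * (K / c)) \<longlonglongrightarrow> 0" by simp
  qed (auto intro!: always_eventually)
  then obtain r :: "nat \<Rightarrow> nat" where r: "strict_mono r"
    and lim0: "AE z in lebesgue. (\<lambda>n. eps (r n) * G (r n) z) \<longlonglongrightarrow> 0"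
    using tendsto_L1_AE_subseq[of lebesgue "\<lambda>n z. eps n * G n z"] G_int by auto
  have lim: "(\<lambda>n. eps n * G n (x, y))
      \<longlonglongrightarrow> (u y)\<^sup>2 * v x * (kernel_k (x - y) / 2 + kernel_j (x - y))"
    if x: "0 < v x" and y: "v y = 0" for x y
  proof -
    have eq: "eps n * G n (x, y)
      = ((cut n (u x))\<^sup>2 * (eps n * eps n / (v x + eps n)) + (cut n (u y))\<^sup>2 * (v x + eps n)
          - 2 * cut n (u x) * cut n (u y) * eps n) * (kernel_k (x - y) / 2)
        + v x * (cut n (u y))\<^sup>2 * kernel_j (x - y)" for n
    proof -
      have *: "e * ((a\<^sup>2 * (e / P) + b\<^sup>2 * (P / e) - 2 * a * b) * k / 2 + q * (b\<^sup>2 / e) * j)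
        = (a\<^sup>2 * (e * e / P) + b\<^sup>2 * P - 2 * a * b * e) * (k / 2) + q * b\<^sup>2 * j"
        if "e \<noteq> 0" for a b e P q k j :: real
      proof -
        have "e * ((a\<^sup>2 * R + b\<^sup>2 * S - 2 * a * b) * k / 2 + q * T * j)
          = (a\<^sup>2 * (e * R) + b\<^sup>2 * (e * S) - 2 * a * b * e) * (k / 2) + q * (e * T) * j" for R S T
          by (simp add: field_simps)
        from this[of "e / P" "P / e" "b\<^sup>2 / e"] show ?thesis using that by simp
      qed
      show ?thesis
        using *[of "eps n" "cut n (u x)" "v x + eps n" "cut n (u y)"] eps_pos[of n]
        by (simp add: G_def picone_deficit_eq[OF nonneg] picone_test_def y)
    qed
    have "(\<lambda>n. eps n * G n (x, y))
      \<longlonglongrightarrow> ((u x)\<^sup>2 * (0 * 0 / (v x + 0)) + (u y)\<^sup>2 * (v x + 0) - 2 * u x * u y * 0) * (kernel_k (x - y) / 2)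
        + v x * (u y)\<^sup>2 * kernel_j (x - y)"
      unfolding eq by (intro tendsto_intros cut_tendsto eps_tendsto) (use x in auto)
    then show ?thesis by (simp add: algebra_simps)
  qed
  have "AE z in lebesgue. \<not> (0 < v (fst z) \<and> (v (snd z) = 0 \<and> u (snd z) \<noteq> 0))"
    using lim0
  proof eventually_elim
    case (elim z)
    obtain x y where z: "z = (x, y)" by (cases z)
    show ?case
    proof
      assume *: "0 < v (fst z) \<and> (v (snd z) = 0 \<and> u (snd z) \<noteq> 0)"
      then have "(\<lambda>n. eps (r n) * G (r n) z)
          \<longlonglongrightarrow> (u y)\<^sup>2 * v x * (kernel_k (x - y) / 2 + kernel_j (x - y))"
        using LIMSEQ_subseq_LIMSEQ[OF lim r, of x y] by (simp add: z o_def)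
      with elim have "(u y)\<^sup>2 * v x * (kernel_k (x - y) / 2 + kernel_j (x - y)) = 0"
        using LIMSEQ_unique by blast
      moreover have "x - y \<noteq> 0" using * by (auto simp: z)
      then have "0 < kernel_k (x - y) / 2 + kernel_j (x - y)"
        using kernel_k_or_j_pos[of "x - y"] kernel_k_nonneg[of "x - y"] kernel_j_nonneg[of "x - y"]
        by linarith
      ultimately show False using * by (simp add: z)
    qed
  qed
  from AE_lebesgue_not_both[OF this] show ?thesis
  proof
    assume "AE x in lebesgue. \<not> 0 < v x"
    then have "AE x in lebesgue. v x = 0"
      by eventually_elim (use nonneg in \<open>auto simp: order.antisym not_less\<close>)
    with nontriv show ?thesis by (simp add: nontrivial_def)
  qed auto
qed

section \<open>The eigenvalue of a nonnegative solution bounds the form from below\<close>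

text \<open>The long-range term enters \<open>\<E>\<^sub>L\<close> with a negative sign, so the bound requires it to be at least
  as large for \<open>(v, \<phi>)\<close> as for \<open>(u, u)\<close> in the limit. The pointwise comparison holds only after
  symmetrization in \<open>x\<close> and \<open>y\<close>, and the limit is the right one because \<open>u\<close> vanishes on the zero set
  of \<open>v\<close>.\<close>

lemma nonneg_solution_form_bound:
  fixes u v :: "'a::euclidean_space \<Rightarrow> real"
  assumes sol: "weak_solution \<Omega> lam v" and nonneg: "\<And>x. 0 \<le> v x" and nontriv: "nontrivial v"
    and u: "u \<in> H_space \<Omega>" and \<Omega>: "\<Omega> \<noteq> UNIV" "\<Omega> \<in> lmeasurable"
  shows "lam * (\<integral>x. u x * u x \<partial>lebesgue) \<le> form_EL u u"
proof -
  define c where "c = c_const DIM('a)"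
  have c: "0 < c" by (simp add: c_def c_const_pos)
  have v: "v \<in> H_space \<Omega>" using sol by (simp add: weak_solution_def)
  have w: "picone_test v u n \<in> H_space \<Omega>" for n
    by (rule picone_test_H_space[OF u v nonneg \<Omega>(1)])
  have [measurable]: "u \<in> borel_measurable lebesgue" "v \<in> borel_measurable lebesgue"
    using H_spaceD(1)[OF u] H_spaceD(1)[OF v] .
  have ui: "integrable lebesgue u" and vi: "integrable lebesgue v"
    and wi: "integrable lebesgue (picone_test v u n)" for n
    by (intro H_space_integrable[OF \<Omega>(2)] u v w)+
  \<comment> \<open>Chosen so that \<open>(p n x)\<^sup>2 = v x * picone_test v u n x\<close>; it absorbs the square roots that the
    arithmetic-geometric mean inequality produces.\<close>
  define p where "p n x = \<bar>cut n (u x)\<bar> * sqrt (v x / (v x + eps n))" for n x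
  have p_bounds: "0 \<le> p n x" "p n x \<le> \<bar>u x\<bar>" for n x
  proof -
    have "0 < v x + eps n" using nonneg[of x] eps_pos[of n] by linarith
    then have "0 \<le> v x / (v x + eps n)" "v x / (v x + eps n) \<le> 1"
      using nonneg[of x] eps_pos[of n] by auto
    then show "0 \<le> p n x" "p n x \<le> \<bar>u x\<bar>"
      unfolding p_def using mult_mono[OF abs_cut_le_abs[of n "u x"], of "sqrt (v x / (v x + eps n))" 1]
      by auto
  qed
  have pm: "p n \<in> borel_measurable lebesgue" for n
    unfolding p_def by measurable
  have pi: "integrable lebesgue (p n)" for n
    by (rule Bochner_Integration.integrable_bound[OF integrable_abs[OF ui] pm])
      (use p_bounds in auto)
  have amgm: "2 * (p n x * p n y) \<le> v x * picone_test v u n y + picone_test v u n x * v y" for n x y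
  proof -
    have pos: "0 < v x + eps n" "0 < v y + eps n" using nonneg[of x] nonneg[of y] eps_pos[of n] by linarith+
    have *: "2 * ((\<bar>a\<bar> * (s / P)) * (\<bar>b\<bar> * (t / Q))) \<le> s\<^sup>2 * (b\<^sup>2 / Q\<^sup>2) + a\<^sup>2 / P\<^sup>2 * t\<^sup>2" for a b s t P Q :: real
      using sum_squares_bound[of "s * \<bar>b\<bar> / Q" "\<bar>a\<bar> * t / P"]
      by (simp add: power_mult_distrib power_divide mult_ac)
    show ?thesis
      using *[of "cut n (u x)" "sqrt (v x)" "sqrt (v x + eps n)" "cut n (u y)" "sqrt (v y)" "sqrt (v y + eps n)"]
        nonneg[of x] nonneg[of y] pos
      by (simp add: p_def picone_test_def real_sqrt_divide)
  qed
  have step: "c * (\<integral>(x, y). p n x * p n y * kernel_j (x - y) \<partial>lebesgue)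
      + (lam - rho_const DIM('a)) * (\<integral>x. v x * picone_test v u n x \<partial>lebesgue) \<le> form_E u u" for n
  proof -
    have D0: "0 \<le> (\<integral>(x, y). picone_deficit v u n x y * kernel_k (x - y) \<partial>lebesgue)"
      by (rule Bochner_Integration.integral_nonneg)
        (auto simp: split_beta kernel_k_nonneg picone_deficit_nonneg[OF nonneg])
    have "2 * (\<integral>(x, y). p n x * p n y * kernel_j (x - y) \<partial>lebesgue)
        = (\<integral>z. 2 * (case z of (x, y) \<Rightarrow> p n x * p n y * kernel_j (x - y)) \<partial>lebesgue)"
      by simp
    also have "\<dots> \<le> (\<integral>z. (case z of (x, y) \<Rightarrow> v x * picone_test v u n y * kernel_j (x - y))
        + (case z of (x, y) \<Rightarrow> picone_test v u n x * v y * kernel_j (x - y)) \<partial>lebesgue)"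
    proof (intro integral_mono integrable_mult_right Bochner_Integration.integrable_add
        integrable_tensor_kernel_j pi vi wi)
      show "2 * (case z of (x, y) \<Rightarrow> p n x * p n y * kernel_j (x - y))
        \<le> (case z of (x, y) \<Rightarrow> v x * picone_test v u n y * kernel_j (x - y))
        + (case z of (x, y) \<Rightarrow> picone_test v u n x * v y * kernel_j (x - y))" for z
        using mult_right_mono[OF amgm[of n "fst z" "snd z"] kernel_j_nonneg[of "fst z - snd z"]]
        by (simp add: split_beta distrib_right mult.assoc)
    qed
    also have "\<dots> = 2 * (\<integral>(x, y). v x * picone_test v u n y * kernel_j (x - y) \<partial>lebesgue)"
      using integral_tensor_kernel_j_commute[OF vi wi[of n]]
      by (subst Bochner_Integration.integral_add[OF integrable_tensor_kernel_j[OF vi wi]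
            integrable_tensor_kernel_j[OF wi vi]]) simp
    finally have "c * (\<integral>(x, y). p n x * p n y * kernel_j (x - y) \<partial>lebesgue)
        \<le> c * (\<integral>(x, y). v x * picone_test v u n y * kernel_j (x - y) \<partial>lebesgue)"
      using c by simp
    moreover have "0 \<le> c / 2 * (\<integral>(x, y). picone_deficit v u n x y * kernel_k (x - y) \<partial>lebesgue)"
      using c D0 by simp
    ultimately show ?thesis
      using picone_energy(2)[OF sol nonneg u \<Omega>(1), of n] unfolding c_def by linarith
  qed
  have zero: "AE x in lebesgue. v x = 0 \<longrightarrow> u x = 0"
    by (rule vanishes_on_zero_set[OF sol nonneg nontriv u \<Omega>])
  have quot: "(\<lambda>n. v x / (v x + eps n)) \<longlonglongrightarrow> 1" if "v x \<noteq> 0" for x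
    by (rule tendsto_eq_intros eps_tendsto refl)+ (use that in auto)
  have plim: "(\<lambda>n. p n x) \<longlonglongrightarrow> \<bar>u x\<bar>" if "v x = 0 \<longrightarrow> u x = 0" for x
  proof (cases "v x = 0")
    case False
    have "(\<lambda>n. p n x) \<longlonglongrightarrow> \<bar>u x\<bar> * sqrt 1"
      unfolding p_def by (intro tendsto_intros cut_tendsto quot False)
    then show ?thesis by simp
  qed (use that in \<open>simp add: p_def\<close>)
  have wlim: "(\<lambda>n. v x * picone_test v u n x) \<longlonglongrightarrow> (u x)\<^sup>2" if "v x = 0 \<longrightarrow> u x = 0" for x
  proof (cases "v x = 0")
    case False
    have "(\<lambda>n. (cut n (u x))\<^sup>2 * (v x / (v x + eps n))) \<longlonglongrightarrow> (u x)\<^sup>2 * 1"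
      by (intro tendsto_intros cut_tendsto quot False)
    then show ?thesis by (simp add: picone_test_def mult.commute)
  qed (use that in simp)
  have L1: "(\<lambda>n. \<integral>x. v x * picone_test v u n x \<partial>lebesgue) \<longlonglongrightarrow> (\<integral>x. (u x)\<^sup>2 \<partial>lebesgue)"
  proof (rule integral_dominated_convergence)
    show "integrable lebesgue (\<lambda>x. (u x)\<^sup>2)" by (rule H_space_integrable_square[OF u])
    show "(\<lambda>x. v x * picone_test v u n x) \<in> borel_measurable lebesgue" for n
      by (intro borel_measurable_times H_spaceD(1)[OF v] H_spaceD(1)[OF w])
    show "AE x in lebesgue. (\<lambda>n. v x * picone_test v u n x) \<longlonglongrightarrow> (u x)\<^sup>2"
      using zero by eventually_elim (rule wlim)
    show "AE x in lebesgue. norm (v x * picone_test v u n x) \<le> (u x)\<^sup>2" for n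
      using mult_picone_test_bounds[of v _ u n, OF nonneg] by (intro AE_I2) simp
  qed measurable
  have L2: "(\<lambda>n. \<integral>(x, y). p n x * p n y * kernel_j (x - y) \<partial>lebesgue)
      \<longlonglongrightarrow> (\<integral>(x, y). \<bar>u x\<bar> * \<bar>u y\<bar> * kernel_j (x - y) \<partial>lebesgue)"
  proof (rule integral_dominated_convergence)
    show i: "integrable lebesgue (\<lambda>(x, y). \<bar>u x\<bar> * \<bar>u y\<bar> * kernel_j (x - y))"
      by (intro integrable_tensor_kernel_j integrable_abs ui)
    then show "(\<lambda>(x, y). \<bar>u x\<bar> * \<bar>u y\<bar> * kernel_j (x - y)) \<in> borel_measurable lebesgue"
      by (rule borel_measurable_integrable)
    show "(\<lambda>(x, y). p n x * p n y * kernel_j (x - y)) \<in> borel_measurable lebesgue" for n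
      by (intro borel_measurable_integrable integrable_tensor_kernel_j pi)
    show "AE z in lebesgue. (\<lambda>n. case z of (x, y) \<Rightarrow> p n x * p n y * kernel_j (x - y))
        \<longlonglongrightarrow> (case z of (x, y) \<Rightarrow> \<bar>u x\<bar> * \<bar>u y\<bar> * kernel_j (x - y))"
      using AE_lebesgue_fst[OF zero] AE_lebesgue_snd[OF zero]
      by eventually_elim (auto simp: split_beta intro!: tendsto_intros plim)
    show "AE z in lebesgue. norm (case z of (x, y) \<Rightarrow> p n x * p n y * kernel_j (x - y))
        \<le> (case z of (x, y) \<Rightarrow> \<bar>u x\<bar> * \<bar>u y\<bar> * kernel_j (x - y))" for n
      using p_bounds
      by (auto simp: split_beta abs_mult kernel_j_nonneg intro!: mult_right_mono mult_mono)
  qed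
  have "c * (\<integral>(x, y). \<bar>u x\<bar> * \<bar>u y\<bar> * kernel_j (x - y) \<partial>lebesgue)
      + (lam - rho_const DIM('a)) * (\<integral>x. (u x)\<^sup>2 \<partial>lebesgue) \<le> form_E u u"
    by (rule LIMSEQ_le_const2[OF tendsto_add[OF tendsto_mult_left[OF L2] tendsto_mult_left[OF L1]]])
      (use step in auto)
  moreover have "c * (\<integral>(x, y). u x * u y * kernel_j (x - y) \<partial>lebesgue)
      \<le> c * (\<integral>(x, y). \<bar>u x\<bar> * \<bar>u y\<bar> * kernel_j (x - y) \<partial>lebesgue)"
  proof (intro mult_left_mono integral_mono integrable_tensor_kernel_j integrable_abs ui)
    show "(case z of (x, y) \<Rightarrow> u x * u y * kernel_j (x - y))
        \<le> (case z of (x, y) \<Rightarrow> \<bar>u x\<bar> * \<bar>u y\<bar> * kernel_j (x - y))" for z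
      by (auto simp: split_beta kernel_j_nonneg intro!: mult_right_mono)
        (metis abs_ge_self abs_mult)
  qed (use c in simp)
  ultimately show ?thesis
    by (simp add: form_EL_def c_def power2_eq_square algebra_simps)
qed

text \<open>The normalized solution attains the lower bound just proved.\<close>

lemma nonneg_solution_eigenvalue:
  fixes v :: "'a::euclidean_space \<Rightarrow> real"
  assumes sol: "weak_solution \<Omega> lam v" and nontriv: "nontrivial v"
    and nonneg: "AE x in lebesgue. 0 \<le> v x" and \<Omega>: "\<Omega> \<noteq> UNIV" "\<Omega> \<in> lmeasurable"
  shows "lam = lambda1 \<Omega>"
proof -
  have a: "weak_solution \<Omega> lam (\<lambda>x. \<bar>v x\<bar>)"
    by (rule weak_solution_abs[OF sol nonneg \<Omega>(1)])
  have an: "nontrivial (\<lambda>x. \<bar>v x\<bar>)" using nontriv by (simp add: nontrivial_def)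
  have v: "v \<in> H_space \<Omega>" using sol by (simp add: weak_solution_def)
  define s where "s = (\<integral>x. v x * v x \<partial>lebesgue)"
  have "s \<noteq> 0"
  proof
    assume "s = 0"
    then have "AE x in lebesgue. v x * v x = 0"
      unfolding s_def
      by (subst (asm) integral_nonneg_eq_0_iff_AE[OF H_space_integrable_mult[OF v v]]) auto
    then show False using nontriv by (simp add: nontrivial_def)
  qed
  moreover have "0 \<le> s" unfolding s_def by simp
  ultimately have s: "0 < s" by simp
  define m where "m x = 1 / sqrt s * v x" for x
  have mH: "m \<in> H_space \<Omega>"
    unfolding m_def by (rule H_space_scale[OF v \<Omega>(1)])
  have "(\<integral>x. m x * m x \<partial>lebesgue) = (\<integral>x. 1 / s * (v x * v x) \<partial>lebesgue)"
    using s by (intro Bochner_Integration.integral_cong) (auto simp: m_def)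
  also have "\<dots> = 1"
    using s by (simp add: s_def)
  finally have m1: "(\<integral>x. m x * m x \<partial>lebesgue) = 1" .
  have "(\<integral>x. v x * m x \<partial>lebesgue) = (\<integral>x. 1 / sqrt s * (v x * v x) \<partial>lebesgue)"
    by (intro Bochner_Integration.integral_cong) (auto simp: m_def)
  then have vm: "(\<integral>x. v x * m x \<partial>lebesgue) = s / sqrt s"
    by (simp add: s_def)
  have "form_EL m m = 1 / sqrt s * form_EL v m"
    unfolding m_def[abs_def] by (rule form_EL_scale)
  also have "form_EL v m = lam * (s / sqrt s)"
    using sol mH by (simp add: weak_solution_def H_space_set_integral_mult[OF v] vm)
  finally have mlam: "form_EL m m = lam"
    using s by simp
  have "(LEAST e. e \<in> {form_EL w w | w. w \<in> H_space \<Omega> \<and> L2_norm_on \<Omega> w = 1}) = lam"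
  proof (rule Least_equality)
    show "lam \<in> {form_EL w w | w. w \<in> H_space \<Omega> \<and> L2_norm_on \<Omega> w = 1}"
      using mH m1 mlam L2_norm_on_H_space[OF mH] by (intro CollectI exI[of _ m]) auto
    fix e assume "e \<in> {form_EL w w | w. w \<in> H_space \<Omega> \<and> L2_norm_on \<Omega> w = 1}"
    then obtain w where w: "w \<in> H_space \<Omega>" "L2_norm_on \<Omega> w = 1" "e = form_EL w w" by auto
    then have "(\<integral>x. w x * w x \<partial>lebesgue) = 1"
      using L2_norm_on_H_space[OF w(1)] by simp
    then show "lam \<le> e"
      using nonneg_solution_form_bound[OF a _ an w(1) \<Omega>] w(3) by simp
  qed
  then show ?thesis by (simp add: lambda1_def)
qed

theorem corollary2p3:
  fixes \<Omega> :: "'a::euclidean_space set"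
  assumes "bounded_C11_domain \<Omega>"
  shows "(\<forall>(lam::real) v. weak_solution \<Omega> lam v \<and> nontrivial v \<and> (AE x in lebesgue. v x \<ge> 0)
            \<longrightarrow> lam = lambda1 \<Omega>)
       \<and> (\<forall>(lam::real) u. weak_solution \<Omega> lam u \<and> nontrivial u \<and> lam > lambda1 \<Omega>
            \<longrightarrow> sign_changing \<Omega> u)"
proof -
  have o: "open \<Omega>" "bounded \<Omega>"
    using assms by (auto simp: bounded_C11_domain_def)
  have \<Omega>: "\<Omega> \<noteq> UNIV" "\<Omega> \<in> lmeasurable"
    using o not_bounded_UNIV by (auto simp: lmeasurable_open)
  note eig = nonneg_solution_eigenvalue[OF _ _ _ \<Omega>]
  \<comment> \<open>Only the positive part is treated; the negative part of \<open>u\<close> is the positive part of \<open>-u\<close>, which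
    solves the same problem.\<close>
  have pos: "0 < emeasure lebesgue {x \<in> \<Omega>. 0 < u x}"
    if sol: "weak_solution \<Omega> lam u" and nontriv: "nontrivial u" and lam: "lambda1 \<Omega> < lam"
    for lam u
  proof (rule ccontr)
    have u: "u \<in> H_space \<Omega>" using sol by (simp add: weak_solution_def)
    have [measurable]: "u \<in> borel_measurable lebesgue" by (rule H_spaceD(1)[OF u])
    have eq: "{x \<in> \<Omega>. 0 < u x} = {x. 0 < u x}"
      using H_spaceD(2)[OF u] by force
    assume "\<not> 0 < emeasure lebesgue {x \<in> \<Omega>. 0 < u x}"
    then have "emeasure lebesgue {x \<in> space lebesgue. \<not> u x \<le> 0} = 0"
      by (simp add: eq not_le zero_less_iff_neq_zero)
    moreover have "{x \<in> space lebesgue. \<not> u x \<le> 0} \<in> sets lebesgue"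
      by measurable
    ultimately have "AE x in lebesgue. u x \<le> 0"
      by (simp only: AE_iff_measurable[OF _ refl])
    then have "AE x in lebesgue. 0 \<le> - u x" by simp
    moreover have "nontrivial (\<lambda>x. - u x)" using nontriv by (simp add: nontrivial_def)
    ultimately have "lam = lambda1 \<Omega>"
      using eig[OF weak_solution_uminus[OF sol \<Omega>(1)]] by blast
    with lam show False by simp
  qed
  have "sign_changing \<Omega> u"
    if "weak_solution \<Omega> lam u" "nontrivial u" "lambda1 \<Omega> < lam" for lam u
  proof -
    have "nontrivial (\<lambda>x. - u x)" using that(2) by (simp add: nontrivial_def)
    from pos[OF weak_solution_uminus[OF that(1) \<Omega>(1)] this that(3)] pos[OF that]
    show ?thesis by (simp add: sign_changing_def)
  qed
  then show ?thesis using eig by blast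
qed

end
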